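(* Let $\mathbf{n}=(n_1,\ldots,n_d)\in\mathbb{N}^d$ have pairwise relatively prime entries. Then $$\#\Gamma^{(\mathbf{n})}=\frac{1}{2^{d-1}}\prod_{i=1}^d(n_i+1).$$
   Context: $\mathbb{N}=\{1,2,\ldots\}$, $\mathbb{N}_0=\mathbb{N}\cup\{0\}$, $d\in\mathbb{N}$. $\Gamma^{(\mathbf{n})}$ is the union of $\{(0,\ldots,0,n_d)\}$ and the set of all $\boldsymbol{\gamma}\in\mathbb{N}_0^d$ such that $\gamma_i<n_i$ for all $i\in\{1,\ldots,d\}$ and $\gamma_i/n_i+\gamma_j/n_j<1$ for all $i,j\in\{1,\ldots,d\}$ with $i\neq j$. *)

theory Defs
  imports Complex_Main "HOL-Library.FuncSet"
begin

text \<open>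
  Elements of \<open>\<nat>\<^sub>0\<^sup>d\<close> are represented as extensional functions on \<open>{1..d}\<close>, so that distinct
  functions are distinct tuples and cardinalities are meaningful.
\<close>

definition Gamma_set :: "nat \<Rightarrow> (nat \<Rightarrow> nat) \<Rightarrow> (nat \<Rightarrow> nat) set" where
  "Gamma_set d n =
     {\<lambda>i\<in>{1..d}. if i = d then n d else 0} \<union>
     {\<gamma> \<in> {1..d} \<rightarrow>\<^sub>E UNIV.
        (\<forall>i\<in>{1..d}. \<gamma> i < n i) \<and>
        (\<forall>i\<in>{1..d}. \<forall>j\<in>{1..d}. i \<noteq> j \<longrightarrow>
           real (\<gamma> i) / real (n i) + real (\<gamma> j) / real (n j) < 1)}"

end

theory Submission
  imports Defs
begin

text \<open>
  The \<open>2\<^sup>d\<^sup>-\<^sup>1\<close> sets \<open>S \<subseteq> {1..d}\<close> of even cardinality act on the box \<open>\<Prod>\<^sub>i {0..n\<^sub>i}\<close> by the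
  reflections \<open>\<gamma>\<^sub>i \<mapsto> n\<^sub>i - \<gamma>\<^sub>i\<close> for \<open>i \<in> S\<close>, and every point of the box is the image of exactly one
  \<open>\<gamma> \<in> \<Gamma>\<close> under exactly one \<open>S\<close>. Uniqueness: a nonempty even \<open>S\<close> has two elements \<open>i \<noteq> j\<close>, and
  reflecting both turns \<open>\<gamma>\<^sub>i/n\<^sub>i + \<gamma>\<^sub>j/n\<^sub>j < 1\<close> into the opposite inequality. Existence: reflect every
  coordinate into \<open>\<gamma>\<^sub>i/n\<^sub>i \<le> 1/2\<close>, and if this takes an odd number of reflections, reflect once more in
  the coordinate nearest to \<open>1/2\<close>. By coprimality this coordinate is unique, except at the vertices
  of the box; the point \<open>(0, \<dots>, 0, n\<^sub>d)\<close> represents the vertices with an odd number of nonzero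
  coordinates.
\<close>

definition reflect :: "('a \<Rightarrow> nat) \<Rightarrow> 'a set \<Rightarrow> ('a \<Rightarrow> nat) \<Rightarrow> 'a \<Rightarrow> nat" where
  "reflect n S \<gamma> = (\<lambda>i. if i \<in> S then n i - \<gamma> i else \<gamma> i)"

lemma reflect_in_box:
  assumes "\<gamma> \<in> (\<Pi>\<^sub>E i\<in>I. {0..n i})" "S \<subseteq> I"
  shows "reflect n S \<gamma> \<in> (\<Pi>\<^sub>E i\<in>I. {0..n i})"
  using assms by (auto simp: reflect_def PiE_iff extensional_def)

text \<open>Subsets of \<open>I\<close> under symmetric difference act on the box: on the overlap
  the two subtractions cancel. Subtraction is truncated, so this cancellation relies on the upper
  bounds \<open>n i\<close>.\<close>

lemma reflect_reflect:
  assumes "\<gamma> \<in> (\<Pi>\<^sub>E i\<in>I. {0..n i})" "S \<subseteq> I" "T \<subseteq> I"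
  shows "reflect n S (reflect n T \<gamma>) = reflect n (sym_diff S T) \<gamma>"
  using assms by (fastforce simp: reflect_def PiE_iff fun_eq_iff)

lemma reflect_ratio:
  assumes "\<gamma> i \<le> n i" "n i \<ge> 1"
  shows "real (reflect n S \<gamma> i) / real (n i) =
    (if i \<in> S then 1 - real (\<gamma> i) / real (n i) else real (\<gamma> i) / real (n i))"
  using assms by (simp add: reflect_def of_nat_diff field_simps)

lemma even_card_sym_diff:
  assumes "finite A" "finite B"
  shows "even (card (sym_diff A B)) \<longleftrightarrow> (even (card A) \<longleftrightarrow> even (card B))"
proof -
  have "card (sym_diff A B) = card (A - B) + card (B - A)"
    using assms by (intro card_Un_disjoint) auto
  moreover have "card A = card (A - B) + card (A \<inter> B)" "card B = card (B - A) + card (A \<inter> B)"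
    using assms card_Int_Diff[of A B] card_Int_Diff[of B A] by (simp_all add: Int_commute)
  ultimately show ?thesis by auto
qed

lemma card_even_subsets:
  assumes "finite A" "A \<noteq> {}"
  shows "card {S. S \<subseteq> A \<and> even (card S)} = 2 ^ (card A - 1)"
proof -
  have fin: "finite {S. S \<subseteq> A \<and> P S}" for P
    using assms(1) by simp
  have "2 ^ card A = card (Pow A)"
    using assms(1) by (simp add: card_Pow)
  also have "Pow A = {S. S \<subseteq> A \<and> even (card S)} \<union> {S. S \<subseteq> A \<and> odd (card S)}"
    by auto
  also have "card \<dots> = card {S. S \<subseteq> A \<and> even (card S)} + card {S. S \<subseteq> A \<and> odd (card S)}"
    by (intro card_Un_disjoint fin) auto
  also have "\<dots> = 2 * card {S. S \<subseteq> A \<and> even (card S)}"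
    \<comment> \<open>A nonempty set has as many even as odd subsets; take those above
      \<open>{}\<close>.\<close>
    using card_subsupersets_even_odd[of A "{}"] assms by (simp add: bot.not_eq_extremum)
  finally show ?thesis
    using assms by (cases "card A") auto
qed

text \<open>Clearing denominators gives \<open>m dvd a * n\<close>, hence \<open>m dvd a\<close>.
  Coprimality enters the whole proof only through this fact.\<close>

lemma coprime_ratios_eq:
  fixes a b m n :: nat
  assumes "coprime m n" "m \<ge> 1" "n \<ge> 1" "real a / real m = real b / real n" "a < m"
  shows "a = 0"
proof -
  have "real (a * n) = real (b * m)"
    using assms by (simp add: field_simps)
  then have "a * n = b * m"
    by (simp only: of_nat_eq_iff)
  then have "m dvd a"
    using assms(1) by (metis coprime_dvd_mult_left_iff dvd_triv_right)
  with assms(5) show ?thesis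
    by (auto dest: dvd_imp_le)
qed

lemma Gamma_set_subset_box: "Gamma_set d n \<subseteq> (\<Pi>\<^sub>E i\<in>{1..d}. {0..n i})"
  by (auto simp: Gamma_set_def PiE_iff less_imp_le) (auto simp: extensional_def)

lemma Gamma_set_cases:
  assumes "\<gamma> \<in> Gamma_set d n"
  obtains (vertex) "\<forall>i\<in>{1..d}. \<gamma> i = (if i = d then n d else 0)"
  | (generic) "\<forall>i\<in>{1..d}. \<gamma> i < n i"
      "\<And>i j. \<lbrakk>i \<in> {1..d}; j \<in> {1..d}; i \<noteq> j\<rbrakk> \<Longrightarrow>
        real (\<gamma> i) / real (n i) + real (\<gamma> j) / real (n j) < 1"
  using assms by (fastforce simp: Gamma_set_def)

lemma Gamma_setI:
  assumes "\<gamma> \<in> (\<Pi>\<^sub>E i\<in>{1..d}. {0..n i})" "\<forall>i\<in>{1..d}. \<gamma> i < n i"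
    and "\<And>i j. \<lbrakk>i \<in> {1..d}; j \<in> {1..d}; i \<noteq> j\<rbrakk> \<Longrightarrow>
      real (\<gamma> i) / real (n i) + real (\<gamma> j) / real (n j) < 1"
  shows "\<gamma> \<in> Gamma_set d n"
  using assms by (auto simp: Gamma_set_def PiE_iff)

lemma reflect_Gamma_set_unique:
  assumes n: "\<forall>i\<in>{1..d}. n i \<ge> 1"
    and \<gamma>: "\<gamma> \<in> Gamma_set d n" and r: "reflect n S \<gamma> \<in> Gamma_set d n"
    and S: "S \<subseteq> {1..d}" "even (card S)"
  shows "S = {}"
proof (rule ccontr)
  assume "S \<noteq> {}"
  have "finite S"
    using S(1) finite_subset by blast
  have le: "\<gamma> i \<le> n i" if "i \<in> {1..d}" for i
    using \<gamma> Gamma_set_subset_box that by fastforce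
  have other: "\<exists>j\<in>S. j \<noteq> k" for k
  proof (rule ccontr)
    assume "\<not> ?thesis"
    with \<open>S \<noteq> {}\<close> have "S = {k}" by auto
    with S(2) show False by simp
  qed
  show False
    using \<gamma>
  proof (cases rule: Gamma_set_cases)
    case vertex
    \<comment> \<open>Coordinate \<open>j\<close> is 0 at the exceptional point, so it is reflected
      to \<open>n j\<close>, which no point of \<open>Gamma_set\<close> has in a coordinate other
      than \<open>d\<close>.\<close>
    obtain j where j: "j \<in> S" "j \<noteq> d" using other by blast
    with S have jd: "j \<in> {1..d}" by auto
    have rj: "reflect n S \<gamma> j = n j"
      using vertex j jd by (auto simp: reflect_def)
    show False
      using r
    proof (cases rule: Gamma_set_cases)
      case vertex
      with rj j jd have "n j = 0" by auto
      with n jd show False by fastforce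
    next
      case generic
      with rj jd show False by fastforce
    qed
  next
    case generic
    \<comment> \<open>Choosing \<open>i\<close> different from \<open>d\<close> excludes the
      exceptional point as image: it would force \<open>\<gamma> i = n i\<close>.\<close>
    obtain i where i: "i \<in> S" "i \<noteq> d" using other by blast
    then have id: "i \<in> {1..d}" using S by auto
    obtain j where j: "j \<in> S" "j \<noteq> i" using other by blast
    then have jd: "j \<in> {1..d}" using S by auto
    show False
      using r
    proof (cases rule: Gamma_set_cases)
      case vertex
      with i id have "reflect n S \<gamma> i = 0" by simp
      with i have "n i \<le> \<gamma> i" by (simp add: reflect_def)
      with generic(1) id show False by fastforce
    next
      case r: generic
      show False
        \<comment> \<open>If the two ratios sum to s, the reflected ones sum to 2 - s; both cannot
          be below 1.\<close>
        using generic(2)[OF id jd] r(2)[OF id jd] i j n id jd le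
        by (simp add: reflect_ratio)
    qed
  qed
qed

lemma ex_reflect_in_Gamma_set:
  assumes d: "d \<ge> 1" and n: "\<forall>i\<in>{1..d}. n i \<ge> 1"
    and coprime: "pairwise (\<lambda>i j. coprime (n i) (n j)) {1..d}"
    and \<gamma>: "\<gamma> \<in> (\<Pi>\<^sub>E i\<in>{1..d}. {0..n i})"
  shows "\<exists>S\<subseteq>{1..d}. even (card S) \<and> reflect n S \<gamma> \<in> Gamma_set d n"
proof -
  \<comment> \<open>A coordinate at exactly half of \<open>n i\<close> is fixed by its reflection,
    so it is left out.\<close>
  define S where "S = {i \<in> {1..d}. 2 * \<gamma> i > n i}"
  define \<beta> where "\<beta> = reflect n S \<gamma>"
  define m where "m i = real (\<beta> i) / real (n i)" for i
  have S: "S \<subseteq> {1..d}" "finite S" by (auto simp: S_def)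
  have \<beta>: "\<beta> \<in> (\<Pi>\<^sub>E i\<in>{1..d}. {0..n i})"
    unfolding \<beta>_def using \<gamma> S(1) by (rule reflect_in_box)
  have \<beta>_half: "2 * \<beta> i \<le> n i" "\<beta> i < n i" if "i \<in> {1..d}" for i
    using that \<gamma> n by (fastforce simp: \<beta>_def reflect_def S_def)+
  have m_half: "m i \<le> 1/2" "m i \<ge> 0" if "i \<in> {1..d}" for i
    using \<beta>_half[OF that] by (simp_all add: m_def field_simps)
  have m_inj: "\<beta> i = 0" "m i = 0" if "i \<in> {1..d}" "j \<in> {1..d}" "i \<noteq> j" "m i = m j" for i j
  proof -
    have "coprime (n i) (n j)" using coprime that by (simp add: pairwise_def)
    then show "\<beta> i = 0"
      using coprime_ratios_eq[of "n i" "n j" "\<beta> i" "\<beta> j"] that n \<beta>_half[of i]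
      by (auto simp: m_def)
    then show "m i = 0" by (simp add: m_def)
  qed
  \<comment> \<open>One extra reflection, in any coordinate, repairs an odd \<open>S\<close>; only
    the choice of \<open>k\<close> remains.\<close>
  have flip: "reflect n {k} \<beta> = reflect n (sym_diff {k} S) \<gamma>" "sym_diff {k} S \<subseteq> {1..d}"
    "even (card (sym_diff {k} S)) \<longleftrightarrow> odd (card S)" if "k \<in> {1..d}" for k
    using that S reflect_reflect[OF \<gamma>, of "{k}" S] even_card_sym_diff[of "{k}" S]
    by (auto simp: \<beta>_def)
  show ?thesis
  proof (cases "even (card S)")
    case True
    have "\<beta> \<in> Gamma_set d n"
    proof (rule Gamma_setI[OF \<beta>])
      show "\<forall>i\<in>{1..d}. \<beta> i < n i" using \<beta>_half by blast
    next
      fix i j assume ij: "i \<in> {1..d}" "j \<in> {1..d}" "i \<noteq> j"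
      \<comment> \<open>A sum of 1 would need both ratios equal to 1/2, but equal ratios are
        0.\<close>
      have "m i + m j < 1"
        using m_half[OF ij(1)] m_half[OF ij(2)] m_inj[OF ij] by fastforce
      then show "real (\<beta> i) / real (n i) + real (\<beta> j) / real (n j) < 1"
        by (simp add: m_def)
    qed
    with True S show ?thesis by (auto simp: \<beta>_def)
  next
    case odd: False
    show ?thesis
    proof (cases "\<forall>i\<in>{1..d}. \<beta> i = 0")
      case True
      \<comment> \<open>Reflecting a zero coordinate \<open>k\<close> yields \<open>n k\<close>,
        which \<open>Gamma_set\<close> admits only at the exceptional point; hence
        \<open>k = d\<close>.\<close>
      have "reflect n {d} \<beta> = (\<lambda>i\<in>{1..d}. if i = d then n d else 0)"
        using True \<beta> d by (auto simp: reflect_def fun_eq_iff PiE_iff extensional_def)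
      then have "reflect n {d} \<beta> \<in> Gamma_set d n"
        by (simp add: Gamma_set_def)
      with flip[of d] odd d show ?thesis
        by (metis atLeastAtMost_iff order_refl)
    next
      case False
      obtain k where k: "k \<in> {1..d}" "\<And>i. i \<in> {1..d} \<Longrightarrow> m i \<le> m k"
      proof -
        have "Max (m ` {1..d}) \<in> m ` {1..d}" using d by (intro Max_in) auto
        then obtain k where "k \<in> {1..d}" "m k = Max (m ` {1..d})" by auto
        then show thesis by (intro that[of k]) auto
      qed
      obtain l where l: "l \<in> {1..d}" "\<beta> l > 0" using False by auto
      moreover from l(1) n have "n l > 0" by fastforce
      ultimately have "m l > 0" by (simp add: m_def)
      then have mk: "m k > 0" using k(2)[OF l(1)] by simp
      \<comment> \<open>The maximum is strict: a tie would make it 0.\<close>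
      have m_less: "m i < m k" if "i \<in> {1..d}" "i \<noteq> k" for i
        using k(2)[OF that(1)] m_inj(2)[OF that(1) k(1) that(2)] mk by linarith
      have ratio: "real (reflect n {k} \<beta> i) / real (n i) = (if i = k then 1 - m i else m i)"
        if "i \<in> {1..d}" for i
        using reflect_ratio[of \<beta> i n "{k}"] \<beta>_half[OF that] n that by (auto simp: m_def)
      have "reflect n {k} \<beta> \<in> Gamma_set d n"
      proof (rule Gamma_setI)
        show "reflect n {k} \<beta> \<in> (\<Pi>\<^sub>E i\<in>{1..d}. {0..n i})"
          using k \<beta> by (intro reflect_in_box) auto
        have "\<beta> k > 0" using mk by (cases "\<beta> k = 0") (simp_all add: m_def)
        then show "\<forall>i\<in>{1..d}. reflect n {k} \<beta> i < n i"
          using \<beta>_half(2) k(1) by (auto simp: reflect_def intro: diff_less le_less_trans[of 0])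
      next
        fix i j assume ij: "i \<in> {1..d}" "j \<in> {1..d}" "i \<noteq> j"
        show "real (reflect n {k} \<beta> i) / real (n i) + real (reflect n {k} \<beta> j) / real (n j) < 1"
          unfolding ratio[OF ij(1)] ratio[OF ij(2)]
          \<comment> \<open>If \<open>k\<close> is one of the two indices, the sum is 1 -
            \<open>m k\<close> plus a ratio below \<open>m k\<close>; otherwise it is below 2
            \<open>m k\<close>, which is at most 1.\<close>
          using m_less[of i] m_less[of j] m_half[of k] k(1) ij by auto
      qed
      with flip[OF k(1)] odd show ?thesis by (intro exI[of _ "sym_diff {k} S"]) simp
    qed
  qed
qed

lemma bij_betw_reflect_Gamma_set:
  assumes "d \<ge> 1" "\<forall>i\<in>{1..d}. n i \<ge> 1"
    and "pairwise (\<lambda>i j. coprime (n i) (n j)) {1..d}"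
  shows "bij_betw (\<lambda>(S, \<gamma>). reflect n S \<gamma>)
    ({S. S \<subseteq> {1..d} \<and> even (card S)} \<times> Gamma_set d n) (\<Pi>\<^sub>E i\<in>{1..d}. {0..n i})"
  (is "bij_betw _ (?E \<times> _) ?B")
proof (rule bij_betw_imageI)
  show "inj_on (\<lambda>(S, \<gamma>). reflect n S \<gamma>) (?E \<times> Gamma_set d n)"
  proof (rule inj_onI, clarify)
    fix S T \<gamma> \<delta>
    assume S: "S \<subseteq> {1..d}" "even (card S)" and T: "T \<subseteq> {1..d}" "even (card T)"
      and \<gamma>: "\<gamma> \<in> Gamma_set d n" and \<delta>: "\<delta> \<in> Gamma_set d n"
      and eq: "reflect n S \<gamma> = reflect n T \<delta>"
    have box: "\<gamma> \<in> ?B" "\<delta> \<in> ?B"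
      using \<gamma> \<delta> Gamma_set_subset_box by blast+
    have fin: "finite S" "finite T"
      using S T finite_subset by blast+
    \<comment> \<open>Undoing \<open>T\<close> on both sides leaves a single even reflection between
      two points of \<open>Gamma_set\<close>.\<close>
    have "reflect n T (reflect n S \<gamma>) = reflect n T (reflect n T \<delta>)"
      by (simp only: eq)
    then have \<delta>_eq: "reflect n (sym_diff T S) \<gamma> = \<delta>"
      by (simp only: reflect_reflect[OF box(1) T(1) S(1)] reflect_reflect[OF box(2) T(1) T(1)])
        (simp add: reflect_def)
    have "sym_diff T S = {}"
    proof (rule reflect_Gamma_set_unique[OF assms(2) \<gamma>])
      show "reflect n (sym_diff T S) \<gamma> \<in> Gamma_set d n"
        using \<delta> by (simp only: \<delta>_eq)
      show "sym_diff T S \<subseteq> {1..d}" using S(1) T(1) by blast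
      show "even (card (sym_diff T S))" using S(2) T(2) even_card_sym_diff[OF fin(2,1)] by blast
    qed
    moreover from this have "S = T" by blast
    ultimately show "S = T \<and> \<gamma> = \<delta>"
      using \<delta>_eq by (simp add: reflect_def)
  qed
  show "(\<lambda>(S, \<gamma>). reflect n S \<gamma>) ` (?E \<times> Gamma_set d n) = ?B"
  proof (intro subset_antisym subsetI)
    fix \<gamma> assume "\<gamma> \<in> (\<lambda>(S, \<gamma>). reflect n S \<gamma>) ` (?E \<times> Gamma_set d n)"
    then obtain S \<delta> where "S \<subseteq> {1..d}" "\<delta> \<in> Gamma_set d n" "\<gamma> = reflect n S \<delta>"
      by auto
    then show "\<gamma> \<in> ?B"
      using reflect_in_box[of \<delta> "{1..d}" n S] Gamma_set_subset_box by blast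
  next
    fix \<gamma> assume \<gamma>: "\<gamma> \<in> ?B"
    then obtain S where S: "S \<subseteq> {1..d}" "even (card S)" "reflect n S \<gamma> \<in> Gamma_set d n"
      using ex_reflect_in_Gamma_set[OF assms] by blast
    have "\<gamma> = reflect n S (reflect n S \<gamma>)"
      by (simp only: reflect_reflect[OF \<gamma> S(1) S(1)]) (simp add: reflect_def)
    with S show "\<gamma> \<in> (\<lambda>(S, \<gamma>). reflect n S \<gamma>) ` (?E \<times> Gamma_set d n)"
      by (intro image_eqI[of _ _ "(S, reflect n S \<gamma>)"]) auto
  qed
qed

theorem proposition2p6:
  fixes d :: nat and n :: "nat \<Rightarrow> nat"
  assumes "d \<ge> 1"
    and "\<forall>i\<in>{1..d}. n i \<ge> 1"
    and "pairwise (\<lambda>i j. coprime (n i) (n j)) {1..d}"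
  shows "real (card (Gamma_set d n)) = 1 / 2 ^ (d - 1) * (\<Prod>i=1..d. real (n i + 1))"
proof -
  have "2 ^ (d - 1) * card (Gamma_set d n) =
      card ({S. S \<subseteq> {1..d} \<and> even (card S)} \<times> Gamma_set d n)"
    using assms(1) card_even_subsets[of "{1..d}"] by (simp add: card_cartesian_product)
  also have "\<dots> = card (\<Pi>\<^sub>E i\<in>{1..d}. {0..n i})"
    using bij_betw_reflect_Gamma_set[OF assms] by (rule bij_betw_same_card)
  also have "\<dots> = (\<Prod>i=1..d. n i + 1)"
    by (simp add: card_PiE)
  finally have "real (2 ^ (d - 1) * card (Gamma_set d n)) = real (\<Prod>i=1..d. n i + 1)"
    by (simp only:)
  then show ?thesis
    by (simp add: field_simps)
qed

end
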